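(* Let $n,k$ be integers with $k$ even and $2\le k\le n-1$, and let $d\in(0,1)$. If there is a transition $I_-\longrightarrow I_+$ at $d$, then there is a transition at $1-d$, namely $I_+^*\longrightarrow I_-^*$, and it has the same multiplicity as the transition at $d$. In particular, if $d$ is an exceptional point, then $1-d$ is an exceptional point.
   Context: Fix integers $n,k$ with $k$ even and $2\le k\le n-1$. Count distributions: for $p\in(0,1)$, a feasible count distribution at $p$ is a vector $(w_s)_{0\le s\le n}$ of real numbers satisfying $$\sum_{s=0}^{n} w_s\binom{s}{r}=\binom{n}{r}p^r\quad(0\le r\le k),\qquad w_s\ge 0\quad(0\le s\le n).$$ (These are the laws of $S=\sum_{i=1}^n X_i$ for $k$-wise independent Bernoulli variables $X_1,\dots,X_n$ with common mean $p$.) An optimal count distribution at $p$ is a feasible count distribution at $p$ maximizing $w_n$ among all feasible count distributions at $p$. The support of a count distribution is $\{s: w_s>0\}$. Paired basis: a set $I=J\cup\{n\}$ where $J=\bigcup_{j=1}^{k/2}\{a_j,a_j+1\}\subseteq\{0,\ldots,n-1\}$ for integers $a_1,\dots,a_{k/2}$ with $a_{j+1}\ge a_j+2$ for $1\le j<k/2$. Thus $|I|=k+1$. Reflection: for a paired basis $I=J\cup\{n\}$, put $J^*=\{n-1-s:s\in J\}$ and $I^*=J^*\cup\{n\}$; this is again a paired basis. Transitions: for $d\in(0,1)$ and distinct paired bases $I_-\ne I_+$, there is a transition $I_-\longrightarrow I_+$ at $d$ if there is $\varepsilon>0$ with $(d-\varepsilon,d+\varepsilon)\subset(0,1)$ such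 that for every $p\in(d-\varepsilon,d)$ the optimal count distribution at $p$ is unique and has support exactly $I_-$, and for every $p\in(d,d+\varepsilon)$ the optimal count distribution at $p$ is unique and has support exactly $I_+$. The multiplicity of this transition is $|I_-\setminus I_+|=|I_+\setminus I_-|$. The point $d$ is exceptional if there is a transition at $d$ whose multiplicity is greater than $1$. *)

theory Defs
  imports Complex_Main
begin

text \<open>
  A count distribution on \<open>{0..n}\<close> is a function on all of \<open>nat\<close> that vanishes above \<open>n\<close>.
  The vanishing condition makes functions correspond one-to-one to vectors \<open>(w\<^sub>0, \<dots>, w\<^sub>n)\<close>;
  uniqueness of an optimum would be meaningless without it.
\<close>

definition feasible :: "nat \<Rightarrow> nat \<Rightarrow> real \<Rightarrow> (nat \<Rightarrow> real) \<Rightarrow> bool" where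
  "feasible n k p w \<longleftrightarrow>
     (\<forall>r\<le>k. (\<Sum>s=0..n. w s * real (s choose r)) = real (n choose r) * p ^ r) \<and>
     (\<forall>s\<le>n. w s \<ge> 0) \<and>
     (\<forall>s>n. w s = 0)"

definition optimal :: "nat \<Rightarrow> nat \<Rightarrow> real \<Rightarrow> (nat \<Rightarrow> real) \<Rightarrow> bool" where
  "optimal n k p w \<longleftrightarrow> feasible n k p w \<and> (\<forall>v. feasible n k p v \<longrightarrow> v n \<le> w n)"

definition supp :: "nat \<Rightarrow> (nat \<Rightarrow> real) \<Rightarrow> nat set" where
  "supp n w = {s. s \<le> n \<and> w s > 0}"

definition unique_optimal_support :: "nat \<Rightarrow> nat \<Rightarrow> real \<Rightarrow> nat set \<Rightarrow> bool" where
  "unique_optimal_support n k p I \<longleftrightarrow>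
     (\<exists>!w. optimal n k p w) \<and> (\<forall>w. optimal n k p w \<longrightarrow> supp n w = I)"

definition paired_basis :: "nat \<Rightarrow> nat \<Rightarrow> nat set \<Rightarrow> bool" where
  "paired_basis n k I \<longleftrightarrow>
     (\<exists>(a :: nat \<Rightarrow> nat) J.
        (\<forall>j. 1 \<le> j \<and> j < k div 2 \<longrightarrow> a (j + 1) \<ge> a j + 2) \<and>
        J = (\<Union>j\<in>{1..k div 2}. {a j, a j + 1}) \<and>
        J \<subseteq> {0..<n} \<and>
        I = J \<union> {n})"

text \<open>
  For a paired basis \<open>I\<close>, the set \<open>J\<close> is recovered as \<open>I - {n}\<close>. Its elements are below \<open>n\<close>,
  so the natural-number subtraction does not truncate.
\<close>

definition reflect :: "nat \<Rightarrow> nat set \<Rightarrow> nat set" where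
  "reflect n I = (\<lambda>s. n - 1 - s) ` (I - {n}) \<union> {n}"

definition transition :: "nat \<Rightarrow> nat \<Rightarrow> real \<Rightarrow> nat set \<Rightarrow> nat set \<Rightarrow> bool" where
  "transition n k d I\<^sub>m I\<^sub>p \<longleftrightarrow>
     0 < d \<and> d < 1 \<and> paired_basis n k I\<^sub>m \<and> paired_basis n k I\<^sub>p \<and> I\<^sub>m \<noteq> I\<^sub>p \<and>
     (\<exists>\<epsilon>>0. {d - \<epsilon><..<d + \<epsilon>} \<subseteq> {0<..<1} \<and>
        (\<forall>p\<in>{d - \<epsilon><..<d}. unique_optimal_support n k p I\<^sub>m) \<and>
        (\<forall>p\<in>{d<..<d + \<epsilon>}. unique_optimal_support n k p I\<^sub>p))"

definition multiplicity :: "nat set \<Rightarrow> nat set \<Rightarrow> nat" where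
  "multiplicity I\<^sub>m I\<^sub>p = card (I\<^sub>m - I\<^sub>p)"

definition exceptional :: "nat \<Rightarrow> nat \<Rightarrow> real \<Rightarrow> bool" where
  "exceptional n k d \<longleftrightarrow> (\<exists>I\<^sub>m I\<^sub>p. transition n k d I\<^sub>m I\<^sub>p \<and> multiplicity I\<^sub>m I\<^sub>p > 1)"

lemma card_paired_union:
  fixes a :: "nat \<Rightarrow> nat"
  assumes "\<forall>j. 1 \<le> j \<and> j < m \<longrightarrow> a (j + 1) \<ge> a j + 2"
  shows "card (\<Union>j\<in>{1..m}. {a j, a j + 1}) = 2 * m \<and>
         (\<forall>j\<in>{1..m}. a j \<le> a m)"
  using assms
proof (induction m)
  case 0
  then show ?case by simp
next
  case (Suc m)
  let ?U = "\<Union>j\<in>{1..m}. {a j, a j + 1}"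
  have IH: "card ?U = 2 * m" "\<forall>j\<in>{1..m}. a j \<le> a m"
    using Suc by auto
  have step: "a j + 2 \<le> a (Suc m)" if "j \<in> {1..m}" for j
  proof -
    have "a m + 2 \<le> a (Suc m)" using Suc.prems that by auto
    then show ?thesis using IH(2) that by fastforce
  qed
  have disj: "?U \<inter> {a (Suc m), a (Suc m) + 1} = {}"
    using step by fastforce
  have split: "(\<Union>j\<in>{1..Suc m}. {a j, a j + 1}) = ?U \<union> {a (Suc m), a (Suc m) + 1}"
    by (auto simp: atLeastAtMostSuc_conv)
  have "card (\<Union>j\<in>{1..Suc m}. {a j, a j + 1}) = 2 * Suc m"
    unfolding split using disj IH(1) by (subst card_Un_disjoint) auto
  moreover have "a j \<le> a (Suc m)" if "j \<in> {1..Suc m}" for j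
    using step[of j] that by (cases "j = Suc m") auto
  ultimately show ?case by blast
qed

lemma card_paired_basis:
  assumes "paired_basis n k I" and "even k"
  shows "finite I" and "card I = k + 1"
proof -
  obtain a :: "nat \<Rightarrow> nat" and J where
    a: "\<forall>j. 1 \<le> j \<and> j < k div 2 \<longrightarrow> a (j + 1) \<ge> a j + 2" and
    J: "J = (\<Union>j\<in>{1..k div 2}. {a j, a j + 1})" "J \<subseteq> {0..<n}" and
    I: "I = J \<union> {n}"
    using assms(1) unfolding paired_basis_def by blast
  have fin: "finite J" using J(2) finite_subset by blast
  then show "finite I" using I by simp
  have "card J = k" using card_paired_union[OF a] J(1) assms(2) by simp
  moreover have "n \<notin> J" using J(2) by auto
  ultimately show "card I = k + 1" using I fin by simp
qed

lemma multiplicity_commute: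
  assumes "paired_basis n k I" and "paired_basis n k I'" and "even k"
  shows "multiplicity I I' = multiplicity I' I"
  using card_paired_basis[OF assms(1,3)] card_paired_basis[OF assms(2,3)]
  unfolding multiplicity_def by (simp add: card_Diff_subset_Int Int_commute)

end

theory Submission
  imports "HOL-Computational_Algebra.Polynomial" Defs
begin

text \<open>
  Feasibility at \<open>p\<close> says that \<open>w\<close> and the binomial law \<open>Bin(n, p)\<close> give the same value to
  every polynomial of degree at most \<open>k\<close>. A paired basis \<open>I = J \<union> {n}\<close> carries the polynomial
  \<open>q(x) = (\<Prod>t\<in>J. x - t)\<close> of degree \<open>k\<close>, which is nonnegative at all integers because its roots
  come in adjacent pairs. Testing with \<open>q\<close> bounds \<open>w n\<close> by a quantity common to all feasible \<open>w\<close>,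
  with equality exactly for distributions supported in \<open>I\<close>; as \<open>I\<close> has \<open>k + 1\<close> elements, there is
  at most one of those. So a feasible \<open>w\<close> whose support lies in a paired basis is the unique optimum
  (\<open>feasible_on_paired_basis_optimal\<close>).

  It remains to turn a feasible distribution at \<open>p\<close> with support \<open>I\<close> into a feasible one at \<open>1 - p\<close>
  with support \<open>reflect n I\<close>. Weighting \<open>s\<close> by \<open>n - s\<close> removes the atom at \<open>n\<close> and turns
  \<open>Bin(n, p)\<close> into a multiple of \<open>Bin(n - 1, p)\<close>; on \<open>{0..n-1}\<close> the map \<open>s \<mapsto> n - 1 - s\<close>
  exchanges the parameters \<open>p\<close> and \<open>1 - p\<close>; undoing the weighting leads to
  \<open>w* u = p / (1 - p) * ((u + 1) / (n - u)) * w (n - 1 - u)\<close> for \<open>u < n\<close>,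
  and the atom at \<open>n\<close> receives the remaining mass. This linear map sends \<open>Bin(n, p)\<close> to
  \<open>Bin(n, 1 - p)\<close> (\<open>reflect_weights_binomial\<close>) and preserves orthogonality to polynomials of
  degree at most \<open>k\<close> (\<open>annihilates_reflect_weights\<close>), hence preserves the moment conditions. Below
  \<open>n\<close> it visibly reflects the support; the atom at \<open>n\<close> is positive since the polynomial \<open>q\<close> of the
  reflected basis has positive mean under \<open>Bin(n, 1 - p)\<close>. Substituting \<open>p \<mapsto> 1 - p\<close> swaps the two
  sides of \<open>d\<close>, which reverses the arrow of a transition.
\<close>

section \<open>Moment conditions as orthogonality to polynomials\<close>

definition annihilates :: "nat \<Rightarrow> nat \<Rightarrow> (nat \<Rightarrow> real) \<Rightarrow> bool" where
  "annihilates n k \<delta> \<longleftrightarrow>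
     (\<forall>q :: real poly. degree q \<le> k \<longrightarrow> (\<Sum>s=0..n. \<delta> s * poly q (real s)) = 0)"

definition binomial_weight :: "nat \<Rightarrow> real \<Rightarrow> nat \<Rightarrow> real" where
  "binomial_weight n p s = real (n choose s) * p ^ s * (1 - p) ^ (n - s)"

lemma sum_binomial_weight: "(\<Sum>s=0..n. binomial_weight n p s) = 1"
  using binomial_ring[of p "1 - p" n]
  by (simp add: binomial_weight_def atMost_atLeast0)

text \<open>
  From \<open>(n choose s) (s choose r) = (n choose r) (n - r choose s - r)\<close>: up to the factor
  \<open>(n choose r) p ^ r\<close> the summands are the weights of \<open>Bin(n - r, p)\<close>, which have total mass one.
\<close>

lemma binomial_weight_moment:
  assumes "r \<le> n"
  shows "(\<Sum>s=0..n. binomial_weight n p s * real (s choose r)) = real (n choose r) * p ^ r"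
proof -
  have "(\<Sum>s=0..n. binomial_weight n p s * real (s choose r))
      = (\<Sum>s=r..n. binomial_weight n p s * real (s choose r))"
    by (rule sum.mono_neutral_right) (auto simp: not_le)
  also have "\<dots> = (\<Sum>t=0..n-r. binomial_weight n p (t + r) * real ((t + r) choose r))"
    using sum.shift_bounds_cl_nat_ivl[of "\<lambda>s. binomial_weight n p s * real (s choose r)" 0 r "n - r"] assms
    by simp
  also have "\<dots> = (\<Sum>t=0..n-r. real (n choose r) * p ^ r * binomial_weight (n - r) p t)"
  proof (rule sum.cong[OF refl])
    fix t assume "t \<in> {0..n-r}"
    then have "(n choose (t + r)) * ((t + r) choose r) = (n choose r) * ((n - r) choose t)"
      using choose_mult[of r "t + r" n] assms by simp
    then have *: "real (n choose (t + r)) * real ((t + r) choose r)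
        = real (n choose r) * real ((n - r) choose t)"
      by (metis of_nat_mult)
    have "n - (t + r) = n - r - t" by simp
    then show "binomial_weight n p (t + r) * real ((t + r) choose r)
        = real (n choose r) * p ^ r * binomial_weight (n - r) p t"
      using * by (simp add: binomial_weight_def power_add)
  qed
  also have "\<dots> = real (n choose r) * p ^ r"
    by (simp add: sum_binomial_weight flip: sum_distrib_left)
  finally show ?thesis .
qed

lemma mult_choose: "real s * real (s choose r) = real (Suc r) * real (s choose Suc r) + real r * real (s choose r)"
proof (cases "r \<le> s")
  case True
  have "Suc r * (s choose Suc r) = (s - r) * (s choose r)"
    by (metis binomial_absorption binomial_absorb_comp)
  then have "real (Suc r) * real (s choose Suc r) = real (s - r) * real (s choose r)"
    by (metis of_nat_mult)
  then show ?thesis using True by (simp add: of_nat_diff algebra_simps)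
qed (simp add: binomial_eq_0)

text \<open>
  Multiplying \<open>s choose r\<close> by \<open>s\<close> gives a combination of \<open>s choose r\<close> and \<open>s choose (r + 1)\<close>
  (\<open>mult_choose\<close>). Carrying the binomial factor along therefore allows an induction on \<open>q\<close>: each
  power of \<open>s\<close> that is split off raises \<open>r\<close> by at most one, so \<open>degree q + r\<close> never exceeds its
  initial bound.
\<close>

lemma annihilates_choose_poly:
  fixes q :: "real poly"
  assumes "\<And>r. r \<le> k \<Longrightarrow> (\<Sum>s=0..n. \<delta> s * real (s choose r)) = 0" and "degree q + r \<le> k"
  shows "(\<Sum>s=0..n. \<delta> s * (poly q (real s) * real (s choose r))) = 0"
  using assms(2)
proof (induction q arbitrary: r rule: pCons_induct)
  case 0
  then show ?case by simp
next
  case (pCons a q)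
  have hd: "(\<Sum>s=0..n. \<delta> s * real (s choose r)) = 0"
    using assms(1) pCons.prems by simp
  have up: "(\<Sum>s=0..n. \<delta> s * (poly q (real s) * real (s choose Suc r))) = 0"
    using pCons by (cases "q = 0") auto
  have same: "(\<Sum>s=0..n. \<delta> s * (poly q (real s) * real (s choose r))) = 0"
    using pCons by (cases "q = 0") auto
  have "(\<Sum>s=0..n. \<delta> s * (poly (pCons a q) (real s) * real (s choose r)))
     = (\<Sum>s=0..n. a * (\<delta> s * real (s choose r))
          + real (Suc r) * (\<delta> s * (poly q (real s) * real (s choose Suc r)))
          + real r * (\<delta> s * (poly q (real s) * real (s choose r))))"
  proof (rule sum.cong[OF refl])
    fix s
    have "poly (pCons a q) (real s) * real (s choose r)
        = a * real (s choose r) + poly q (real s) * (real s * real (s choose r))"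
      by (simp add: algebra_simps)
    also have "\<dots> = a * real (s choose r) + poly q (real s) *
         (real (Suc r) * real (s choose Suc r) + real r * real (s choose r))"
      by (simp only: mult_choose)
    finally show "\<delta> s * (poly (pCons a q) (real s) * real (s choose r)) = a * (\<delta> s * real (s choose r))
          + real (Suc r) * (\<delta> s * (poly q (real s) * real (s choose Suc r)))
          + real r * (\<delta> s * (poly q (real s) * real (s choose r)))"
      by (simp only:) (simp only: algebra_simps)
  qed
  also have "\<dots> = 0"
    by (simp only: sum.distrib hd up same mult_zero_right add_0_right flip: sum_distrib_left)
  finally show ?case .
qed

lemma choose_is_poly: "\<exists>q :: real poly. degree q \<le> r \<and> (\<forall>s. poly q (real s) = real (s choose r))"
proof (induction r)
  case 0
  show ?case by (intro exI[of _ 1]) simp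
next
  case (Suc r)
  then obtain q :: "real poly" where q: "degree q \<le> r" "\<And>s. poly q (real s) = real (s choose r)"
    by auto
  let ?l = "[:- real r / real (Suc r), 1 / real (Suc r):]"
  have "degree (q * ?l) \<le> Suc r"
    using degree_mult_le[of q ?l] q(1) by simp
  moreover have "poly (q * ?l) (real s) = real (s choose Suc r)" for s
  proof -
    have "(real s - real r) * real (s choose r) = real (Suc r) * real (s choose Suc r)"
      using mult_choose[of s r] by (simp only: left_diff_distrib)
    moreover have "poly ?l (real s) = (real s - real r) / real (Suc r)"
      by (simp add: diff_divide_distrib)
    ultimately have "poly (q * ?l) (real s) = real (Suc r) * real (s choose Suc r) / real (Suc r)"
      by (simp only: poly_mult q(2) times_divide_eq_right mult.commute)
    then show ?thesis by simp
  qed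
  ultimately show ?case by blast
qed

lemma annihilates_iff_choose:
  "annihilates n k \<delta> \<longleftrightarrow> (\<forall>r\<le>k. (\<Sum>s=0..n. \<delta> s * real (s choose r)) = 0)"
proof
  assume ann: "annihilates n k \<delta>"
  show "\<forall>r\<le>k. (\<Sum>s=0..n. \<delta> s * real (s choose r)) = 0"
  proof (intro allI impI)
    fix r assume "r \<le> k"
    obtain q :: "real poly" where "degree q \<le> r" "\<And>s. poly q (real s) = real (s choose r)"
      using choose_is_poly by blast
    then show "(\<Sum>s=0..n. \<delta> s * real (s choose r)) = 0"
      using ann \<open>r \<le> k\<close> unfolding annihilates_def by (metis (no_types, lifting) order_trans sum.cong)
  qed
next
  assume "\<forall>r\<le>k. (\<Sum>s=0..n. \<delta> s * real (s choose r)) = 0"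
  then show "annihilates n k \<delta>"
    unfolding annihilates_def using annihilates_choose_poly[where r = 0 and k = k and n = n and \<delta> = \<delta>] by simp
qed

lemma feasible_iff_annihilates:
  assumes "k \<le> n"
  shows "feasible n k p w \<longleftrightarrow> annihilates n k (\<lambda>s. w s - binomial_weight n p s) \<and>
           (\<forall>s\<le>n. w s \<ge> 0) \<and> (\<forall>s>n. w s = 0)"
proof -
  have "(\<Sum>s=0..n. w s * real (s choose r)) = real (n choose r) * p ^ r \<longleftrightarrow>
      (\<Sum>s=0..n. (w s - binomial_weight n p s) * real (s choose r)) = 0" if "r \<le> k" for r
    using binomial_weight_moment[of r n p] that assms
    by (simp add: left_diff_distrib sum_subtractf)
  then show ?thesis
    unfolding feasible_def annihilates_iff_choose by auto
qed

lemma feasible_sum_poly: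
  fixes q :: "real poly"
  assumes "feasible n k p w" and "k \<le> n" and "degree q \<le> k"
  shows "(\<Sum>s=0..n. w s * poly q (real s)) = (\<Sum>s=0..n. binomial_weight n p s * poly q (real s))"
  using assms by (auto simp: feasible_iff_annihilates annihilates_def left_diff_distrib sum_subtractf)

text \<open>
  The Lagrange numerator that vanishes on all of \<open>I\<close> except \<open>s\<close> has degree \<open>k\<close> and isolates
  \<open>\<delta> s\<close>.
\<close>

lemma annihilates_eq_zero:
  assumes ann: "annihilates n k \<delta>" and "finite I" and "card I = Suc k"
    and supp: "\<And>s. s \<le> n \<Longrightarrow> s \<notin> I \<Longrightarrow> \<delta> s = 0" and "s \<le> n"
  shows "\<delta> s = 0"
proof (cases "s \<in> I")
  case True
  define q :: "real poly" where "q = (\<Prod>t\<in>I - {s}. [:- real t, 1:])"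
  have "degree q \<le> k"
    using degree_prod_sum_le[of "I - {s}" "\<lambda>t. [:- real t, 1:]"] assms(2,3) True
    by (simp add: q_def)
  then have "0 = (\<Sum>u=0..n. \<delta> u * poly q (real u))"
    using ann by (simp add: annihilates_def)
  also have "\<dots> = (\<Sum>u\<in>{s}. \<delta> u * poly q (real u))"
  proof (rule sum.mono_neutral_right)
    have "poly q (real u) = 0" if "u \<in> I" "u \<noteq> s" for u
      using that \<open>finite I\<close> by (auto simp: q_def poly_prod)
    then show "\<forall>u\<in>{0..n} - {s}. \<delta> u * poly q (real u) = 0"
      using supp by fastforce
  qed (use \<open>s \<le> n\<close> in auto)
  finally have "\<delta> s * poly q (real s) = 0" by simp
  moreover have "poly q (real s) \<noteq> 0"
    using \<open>finite I\<close> by (auto simp: q_def poly_prod)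
  ultimately show ?thesis by simp
qed (use assms in auto)

section \<open>Paired bases certify optimality\<close>

text \<open>
  The dual certificate. It is the product of \<open>(x - a\<^sub>j) (x - a\<^sub>j - 1)\<close>, and no integer lies strictly
  between the two roots of a factor, so each factor is nonnegative at every integer.
\<close>

lemma paired_basis_certificate:
  assumes "paired_basis n k I" and "even k"
  obtains q :: "real poly" where "degree q \<le> k" and "\<And>s. poly q (real s) \<ge> 0"
    and "\<And>s. s < n \<Longrightarrow> poly q (real s) = 0 \<longleftrightarrow> s \<in> I" and "poly q (real n) > 0"
proof -
  obtain a :: "nat \<Rightarrow> nat" where
    J: "(\<Union>j\<in>{1..k div 2}. {a j, a j + 1}) \<subseteq> {0..<n}" and
    I: "I = (\<Union>j\<in>{1..k div 2}. {a j, a j + 1}) \<union> {n}"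
    using assms(1) unfolding paired_basis_def by blast
  define q :: "real poly" where
    "q = (\<Prod>j\<in>{1..k div 2}. [:- real (a j), 1:] * [:- real (a j + 1), 1:])"
  have "degree q \<le> (\<Sum>j\<in>{1..k div 2}. degree ([:- real (a j), 1:] * [:- real (a j + 1), 1:]))"
    unfolding q_def by (rule degree_prod_sum_le[unfolded o_def]) simp
  also have "\<dots> = k"
    using \<open>even k\<close> by (auto elim!: evenE)
  finally have deg: "degree q \<le> k" .
  have eval: "poly q (real s) = (\<Prod>j\<in>{1..k div 2}. (real s - real (a j)) * (real s - real (a j + 1)))" for s
    by (simp add: q_def poly_prod algebra_simps)
  have nonneg: "poly q (real s) \<ge> 0" for s
    unfolding eval
  proof (rule prod_nonneg)
    fix j
    have "s \<le> a j \<or> s \<ge> a j + 1" by linarith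
    then show "(real s - real (a j)) * (real s - real (a j + 1)) \<ge> 0"
      by (auto intro: mult_nonneg_nonneg mult_nonpos_nonpos)
  qed
  have zero: "poly q (real s) = 0 \<longleftrightarrow> s \<in> (\<Union>j\<in>{1..k div 2}. {a j, a j + 1})" for s
  proof -
    have "(real s - real (a j)) * (real s - real (a j + 1)) = 0 \<longleftrightarrow> s \<in> {a j, a j + 1}" for j
      by (auto simp flip: of_nat_Suc)
    then show ?thesis
      unfolding eval by (auto simp: prod_zero_iff)
  qed
  have "poly q (real n) \<noteq> 0"
    using J unfolding zero by (meson atLeastLessThan_iff less_irrefl subsetD)
  then have "poly q (real n) > 0"
    using nonneg[of n] by linarith
  with deg nonneg zero I show ?thesis
    by (intro that[of q]) (simp_all add: less_imp_neq)
qed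

text \<open>
  Complementary slackness for the certificate \<open>q\<close>. The mean of \<open>q\<close> is the same for all feasible
  distributions; for \<open>w\<close> only the atom at \<open>n\<close> contributes to it, while for a competitor \<open>v\<close> the
  atoms below \<open>n\<close> add a nonnegative amount. A competitor that attains \<open>w n\<close> is thus supported in
  \<open>I\<close>, and then the moment conditions determine it.
\<close>

lemma feasible_on_paired_basis_optimal:
  assumes I: "paired_basis n k I" and "even k" and "k \<le> n"
    and w: "feasible n k p w" and "supp n w \<subseteq> I"
  shows "optimal n k p w" and "optimal n k p v \<Longrightarrow> v = w"
proof -
  obtain q :: "real poly" where q: "degree q \<le> k" "\<And>s. poly q (real s) \<ge> 0"
    "\<And>s. s < n \<Longrightarrow> poly q (real s) = 0 \<longleftrightarrow> s \<in> I" "poly q (real n) > 0"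
    using paired_basis_certificate[OF I \<open>even k\<close>] by metis
  have wI: "w s = 0" if "s \<le> n" "s \<notin> I" for s
    using w \<open>supp n w \<subseteq> I\<close> that unfolding supp_def feasible_def by force
  have split: "(\<Sum>s=0..n. u s * poly q (real s)) = u n * poly q (real n) + (\<Sum>s<n. u s * poly q (real s))"
    for u :: "nat \<Rightarrow> real"
    by (simp add: atLeast0AtMost lessThan_Suc_atMost[symmetric])
  have "(\<Sum>s<n. w s * poly q (real s)) = 0"
    using q(3) wI by (intro sum.neutral) fastforce
  then have value_eq: "v n * poly q (real n) + (\<Sum>s<n. v s * poly q (real s)) = w n * poly q (real n)"
    if "feasible n k p v" for v
    using feasible_sum_poly[OF that \<open>k \<le> n\<close> q(1)] feasible_sum_poly[OF w \<open>k \<le> n\<close> q(1)]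
    by (simp add: split)
  have tail: "v s * poly q (real s) \<ge> 0" if "feasible n k p v" "s < n" for v s
    using that q(2) by (auto simp: feasible_def)
  have "v n \<le> w n" if "feasible n k p v" for v
  proof -
    have "v n * poly q (real n) \<le> w n * poly q (real n)"
      using value_eq[OF that] sum_nonneg[of "{..<n}" "\<lambda>s. v s * poly q (real s)"] tail[OF that] by auto
    then show ?thesis using q(4) by simp
  qed
  with w show opt: "optimal n k p w"
    by (simp add: optimal_def)
  assume vopt: "optimal n k p v"
  then have v: "feasible n k p v" and "v n = w n"
    using opt by (auto simp: optimal_def intro: antisym)
  then have "(\<Sum>s<n. v s * poly q (real s)) = 0"
    using value_eq[OF v] by simp
  then have "v s * poly q (real s) = 0" if "s < n" for s
    using sum_nonneg_eq_0_iff[of "{..<n}" "\<lambda>s. v s * poly q (real s)"] tail[OF v] that by auto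
  moreover have "n \<in> I"
    using I by (auto simp: paired_basis_def)
  ultimately have vI: "v s = 0" if "s \<le> n" "s \<notin> I" for s
    using q(3) that by (metis le_neq_implies_less mult_eq_0_iff)
  have ann: "annihilates n k (\<lambda>s. v s - w s)"
    unfolding annihilates_def using feasible_sum_poly[OF v \<open>k \<le> n\<close>] feasible_sum_poly[OF w \<open>k \<le> n\<close>]
    by (simp add: left_diff_distrib sum_subtractf)
  have "v s = w s" if "s \<le> n" for s
    using annihilates_eq_zero[OF ann card_paired_basis(1)[OF I \<open>even k\<close>] _ _ that]
      card_paired_basis(2)[OF I \<open>even k\<close>] vI wI by simp
  moreover have "v s = w s" if "s > n" for s
    using v w that by (simp add: feasible_def)
  ultimately show "v = w"
    by (meson ext not_le)
qed

section \<open>Reflection of count distributions\<close>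

text \<open>
  The value at \<open>n\<close> makes the map preserve total mass instead of being written as \<open>1 - \<dots>\<close>, so that
  the map is linear and applies to differences of distributions as well.
\<close>

definition reflect_weights :: "nat \<Rightarrow> real \<Rightarrow> (nat \<Rightarrow> real) \<Rightarrow> nat \<Rightarrow> real" where
  "reflect_weights n p w u =
    (let f = (\<lambda>u. p / (1 - p) * (real (u + 1) / real (n - u)) * w (n - 1 - u))
     in if u < n then f u else if u = n then (\<Sum>s=0..n. w s) - (\<Sum>u<n. f u) else 0)"

lemma reflect_weights_below:
  "u < n \<Longrightarrow> reflect_weights n p w u = p / (1 - p) * (real (u + 1) / real (n - u)) * w (n - 1 - u)"
  by (simp add: reflect_weights_def)

lemma reflect_weights_above: "u > n \<Longrightarrow> reflect_weights n p w u = 0"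
  by (simp add: reflect_weights_def)

lemma reflect_weights_at_n:
  "reflect_weights n p w n = (\<Sum>s=0..n. w s) - (\<Sum>u<n. reflect_weights n p w u)"
  by (simp add: reflect_weights_def)

lemma reflect_weights_diff:
  "reflect_weights n p (\<lambda>s. w s - v s) u = reflect_weights n p w u - reflect_weights n p v u"
proof -
  have below: "reflect_weights n p (\<lambda>s. w s - v s) u = reflect_weights n p w u - reflect_weights n p v u"
    if "u < n" for u
    using that by (simp add: reflect_weights_below right_diff_distrib)
  then have at: "reflect_weights n p (\<lambda>s. w s - v s) n = reflect_weights n p w n - reflect_weights n p v n"
    unfolding reflect_weights_at_n by (simp add: sum_subtractf)
  show ?thesis
    using below at by (metis linorder_neqE_nat reflect_weights_above diff_self)
qed

text \<open>
  Below \<open>n\<close> this is the identity \<open>(u + 1) (n choose (u + 1)) = (n - u) (n choose u)\<close>, the factor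
  \<open>p / (1 - p)\<close> moving one power from \<open>1 - p\<close> to \<open>p\<close>; at \<open>n\<close> both laws have total mass one.
\<close>

lemma reflect_weights_binomial:
  assumes "p \<noteq> 1"
  shows "reflect_weights n p (binomial_weight n p) = binomial_weight n (1 - p)"
proof -
  have below: "reflect_weights n p (binomial_weight n p) u = binomial_weight n (1 - p) u" if "u < n" for u
  proof -
    have "Suc u * (n choose Suc u) = (n - u) * (n choose u)"
      by (metis binomial_absorption binomial_absorb_comp)
    then have "real (Suc u) * real (n choose Suc u) = real (n - u) * real (n choose u)"
      by (metis of_nat_mult)
    then have ratio: "real (Suc u) / real (n - u) * real (n choose Suc u) = real (n choose u)"
      using that by (simp add: field_simps)
    have sym: "n choose (n - 1 - u) = n choose Suc u"
      using that binomial_symmetric[of "Suc u" n] by simp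
    have "n - (n - 1 - u) = Suc u"
      using that by simp
    then have "reflect_weights n p (binomial_weight n p) u
        = p / (1 - p) * (real (Suc u) / real (n - u)) *
            (real (n choose Suc u) * p ^ (n - 1 - u) * (1 - p) ^ Suc u)"
      using that sym by (simp add: reflect_weights_below binomial_weight_def)
    also have "\<dots> = (real (Suc u) / real (n - u) * real (n choose Suc u)) *
        (p * p ^ (n - 1 - u)) * ((1 - p) ^ Suc u / (1 - p))"
      by (simp add: mult_ac)
    also have "\<dots> = real (n choose u) * p ^ (n - u) * (1 - p) ^ u"
    proof -
      have "p * p ^ (n - 1 - u) = p ^ Suc (n - 1 - u)" by simp
      also have "Suc (n - 1 - u) = n - u" using that by simp
      finally have "p * p ^ (n - 1 - u) = p ^ (n - u)" .
      moreover have "(1 - p) ^ Suc u / (1 - p) = (1 - p) ^ u" using assms by simp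
      ultimately show ?thesis unfolding ratio by (simp only:)
    qed
    finally show ?thesis
      by (simp add: binomial_weight_def)
  qed
  have "(\<Sum>u<n. binomial_weight n (1 - p) u) + binomial_weight n (1 - p) n = 1"
    using sum_binomial_weight[of n "1 - p"] by (simp add: atLeast0AtMost lessThan_Suc_atMost[symmetric])
  then have "reflect_weights n p (binomial_weight n p) n = binomial_weight n (1 - p) n"
    unfolding reflect_weights_at_n sum_binomial_weight using below by simp
  moreover have "reflect_weights n p (binomial_weight n p) u = binomial_weight n (1 - p) u" if "u > n" for u
    using that by (simp add: reflect_weights_above binomial_weight_def)
  ultimately show ?thesis
    using below by (metis ext linorder_neqE_nat)
qed

text \<open>
  Split a test polynomial as \<open>f x = f n - (n - x) * h x\<close> with \<open>h\<close> of smaller degree. The constant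
  part is annihilated because the total mass is zero. In the other part \<open>n - u\<close> cancels the
  denominator of the reflected weight and the substitution \<open>s = n - 1 - u\<close> turns the numerator
  \<open>u + 1\<close> into \<open>n - s\<close>; what remains is \<open>\<delta>\<close> tested with \<open>(n - x) * h (n - 1 - x)\<close>, again a
  polynomial of degree at most \<open>k\<close>.
\<close>

lemma annihilates_reflect_weights:
  assumes ann: "annihilates n k \<delta>"
  shows "annihilates n k (reflect_weights n p \<delta>)"
  unfolding annihilates_def
proof (intro allI impI)
  fix f :: "real poly"
  assume f: "degree f \<le> k"
  let ?c = "p / (1 - p)"
  have "poly (f - [:poly f (real n):]) (real n) = 0" by simp
  then obtain h where h: "f - [:poly f (real n):] = [:- real n, 1:] * h"
    unfolding poly_eq_0_iff_dvd by (elim dvdE)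
  define g where "g = pcompose h [:real n - 1, -1:]"
  have "degree (f - [:poly f (real n):]) \<le> k"
    using f by (intro degree_diff_le) auto
  then have h_deg: "h \<noteq> 0 \<Longrightarrow> Suc (degree h) \<le> k"
    unfolding h by (subst (asm) degree_mult_eq) auto
  have g_deg: "degree ([:real n, -1:] * g) \<le> k"
  proof (cases "h = 0")
    case True
    then show ?thesis by (simp add: g_def)
  next
    case False
    have "degree g \<le> degree h"
      unfolding g_def using degree_pcompose_le[of h "[:real n - 1, -1:]"] by simp
    then show ?thesis
      using degree_mult_le[of "[:real n, -1:]" g] h_deg[OF False] by simp
  qed
  have f_eval: "poly f x = poly f (real n) - (real n - x) * poly h x" for x
    using arg_cong[OF h, of "\<lambda>q. poly q x"] by (simp add: algebra_simps)
  have reindex: "(\<Sum>u<n. reflect_weights n p \<delta> u * ((real n - real u) * poly h (real u)))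
      = (\<Sum>s<n. ?c * (\<delta> s * poly ([:real n, -1:] * g) (real s)))"
  proof (rule sum.reindex_bij_witness[of _ "\<lambda>s. n - 1 - s" "\<lambda>s. n - 1 - s"])
    fix u assume "u \<in> {..<n}"
    then have u: "u < n" by simp
    then have cast: "real (n - 1 - u) = real n - 1 - real u"
      by (simp add: of_nat_diff)
    have at: "poly ([:real n, -1:] * g) (real (n - 1 - u)) = real (u + 1) * poly h (real u)"
      unfolding cast by (simp add: g_def poly_pcompose algebra_simps)
    have cancel: "real (u + 1) / real (n - u) * (real n - real u) = real (u + 1)"
      using u by (simp add: of_nat_diff)
    have "reflect_weights n p \<delta> u * ((real n - real u) * poly h (real u))
        = ?c * (\<delta> (n - 1 - u) * ((real (u + 1) / real (n - u) * (real n - real u)) * poly h (real u)))"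
      by (simp only: reflect_weights_below[OF u] mult_ac)
    then show "?c * (\<delta> (n - 1 - u) * poly ([:real n, -1:] * g) (real (n - 1 - u)))
        = reflect_weights n p \<delta> u * ((real n - real u) * poly h (real u))"
      unfolding at cancel by simp
  qed auto
  have mass: "(\<Sum>s=0..n. \<delta> s) = 0"
    using ann[unfolded annihilates_def, rule_format, of 1] by simp
  have "(\<Sum>s=0..n. \<delta> s * poly ([:real n, -1:] * g) (real s)) = 0"
    using ann g_deg unfolding annihilates_def by blast
  then have vanish: "(\<Sum>s<n. \<delta> s * poly ([:real n, -1:] * g) (real s)) = 0"
    by (simp add: atLeast0AtMost lessThan_Suc_atMost[symmetric])
  have "(\<Sum>u=0..n. reflect_weights n p \<delta> u * poly f (real u))
      = reflect_weights n p \<delta> n * poly f (real n) + (\<Sum>u<n. reflect_weights n p \<delta> u * poly f (real u))"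
    by (simp add: atLeast0AtMost lessThan_Suc_atMost[symmetric])
  also have "(\<Sum>u<n. reflect_weights n p \<delta> u * poly f (real u))
      = (\<Sum>u<n. reflect_weights n p \<delta> u) * poly f (real n)
        - (\<Sum>u<n. reflect_weights n p \<delta> u * ((real n - real u) * poly h (real u)))"
    by (subst f_eval) (simp add: right_diff_distrib sum_subtractf sum_distrib_right)
  also have "(\<Sum>u<n. reflect_weights n p \<delta> u * ((real n - real u) * poly h (real u))) = 0"
    unfolding reindex using vanish by (simp only: mult_zero_right flip: sum_distrib_left)
  finally show "(\<Sum>u=0..n. reflect_weights n p \<delta> u * poly f (real u)) = 0"
    by (simp add: reflect_weights_at_n mass algebra_simps)
qed

section \<open>Reflection of paired bases\<close>

lemma mem_reflect_iff:
  assumes "u < n" and "I \<subseteq> {0..n}"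
  shows "u \<in> reflect n I \<longleftrightarrow> n - 1 - u \<in> I"
proof
  assume "u \<in> reflect n I"
  then obtain s where "s \<in> I" "s \<noteq> n" "u = n - 1 - s"
    using assms by (auto simp: reflect_def)
  moreover from this have "s < n" using assms by fastforce
  ultimately show "n - 1 - u \<in> I" by simp
next
  assume "n - 1 - u \<in> I"
  then show "u \<in> reflect n I"
    using assms unfolding reflect_def by (intro UnI1 image_eqI[of _ _ "n - 1 - u"]) auto
qed

lemma paired_basis_subset: "paired_basis n k I \<Longrightarrow> I \<subseteq> {0..n}"
  and paired_basis_top: "paired_basis n k I \<Longrightarrow> n \<in> I"
  by (fastforce simp: paired_basis_def)+

text \<open>
  Reflection exchanges the two members of a pair and reverses the order of the pairs, so the lower
  ends of the reflected pairs are \<open>n - 1 - (a\<^sub>i + 1) = n - 2 - a\<^sub>i\<close>, listed with \<open>i\<close> descending.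
\<close>

lemma paired_basis_reflect:
  assumes "paired_basis n k I"
  shows "paired_basis n k (reflect n I)"
proof -
  let ?m = "k div 2"
  obtain a :: "nat \<Rightarrow> nat" where
    a: "\<And>j. 1 \<le> j \<Longrightarrow> j < ?m \<Longrightarrow> a (j + 1) \<ge> a j + 2" and
    J: "(\<Union>j\<in>{1..?m}. {a j, a j + 1}) \<subseteq> {0..<n}" and
    I: "I = (\<Union>j\<in>{1..?m}. {a j, a j + 1}) \<union> {n}"
    using assms unfolding paired_basis_def by blast
  define b where "b j = n - 2 - a (?m + 1 - j)" for j
  have bound: "a j + 2 \<le> n" if "j \<in> {1..?m}" for j
    using J that by fastforce
  have pair: "{b j, b j + 1} = (\<lambda>s. n - 1 - s) ` {a (?m + 1 - j), a (?m + 1 - j) + 1}" if "j \<in> {1..?m}" for j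
  proof -
    have "a (?m + 1 - j) + 2 \<le> n" using that by (intro bound) auto
    then have "b j = n - 1 - (a (?m + 1 - j) + 1)" "b j + 1 = n - 1 - a (?m + 1 - j)"
      by (simp_all add: b_def)
    then show ?thesis by (simp only: image_insert image_empty insert_commute)
  qed
  have "(\<lambda>j. ?m + 1 - j) ` {1..?m} = {1..?m}"
  proof (intro equalityI subsetI)
    fix j assume "j \<in> {1..?m}"
    then show "j \<in> (\<lambda>j. ?m + 1 - j) ` {1..?m}"
      by (intro image_eqI[of _ _ "?m + 1 - j"]) auto
  qed auto
  then have "(\<Union>j\<in>{1..?m}. {a j, a j + 1}) = (\<Union>j\<in>{1..?m}. {a (?m + 1 - j), a (?m + 1 - j) + 1})"
    by (metis (no_types, lifting) image_image SUP_cong)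
  then have "(\<lambda>s. n - 1 - s) ` (\<Union>j\<in>{1..?m}. {a j, a j + 1}) = (\<Union>j\<in>{1..?m}. {b j, b j + 1})"
    using pair by (simp add: image_UN)
  moreover have "I - {n} = (\<Union>j\<in>{1..?m}. {a j, a j + 1})"
    using I J by auto
  ultimately have refl: "reflect n I = (\<Union>j\<in>{1..?m}. {b j, b j + 1}) \<union> {n}"
    by (simp add: reflect_def)
  have "b (j + 1) \<ge> b j + 2" if "1 \<le> j" "j < ?m" for j
  proof -
    have "?m + 1 - (j + 1) = ?m - j" "?m - j + 1 = ?m + 1 - j"
      using that by auto
    then have "a (?m + 1 - j) \<ge> a (?m + 1 - (j + 1)) + 2"
      using a[of "?m - j"] that by simp
    moreover have "a (?m + 1 - j) + 2 \<le> n"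
      using that by (intro bound) auto
    ultimately show ?thesis unfolding b_def by linarith
  qed
  moreover have "(\<Union>j\<in>{1..?m}. {b j, b j + 1}) \<subseteq> {0..<n}"
    using bound by (fastforce simp: b_def)
  ultimately show ?thesis
    unfolding paired_basis_def using refl by blast
qed

lemma paired_basis_diff_below:
  assumes "paired_basis n k I" and "paired_basis n k I'" and "s \<in> I - I'"
  shows "s < n"
proof -
  have "s \<le> n" using paired_basis_subset[OF assms(1)] assms(3) by auto
  moreover have "s \<noteq> n" using paired_basis_top[OF assms(2)] assms(3) by auto
  ultimately show ?thesis by simp
qed

lemma reflect_diff:
  assumes "paired_basis n k I" and "paired_basis n k I'"
  shows "reflect n I - reflect n I' = (\<lambda>s. n - 1 - s) ` (I - I')"
proof -
  note sub = paired_basis_subset[OF assms(1)] paired_basis_subset[OF assms(2)]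
  have below: "u < n" if "u \<in> reflect n I - reflect n I'" for u
    using paired_basis_diff_below[OF paired_basis_reflect[OF assms(1)] paired_basis_reflect[OF assms(2)] that] .
  have mem: "u \<in> reflect n I - reflect n I' \<longleftrightarrow> n - 1 - u \<in> I - I'" if "u < n" for u
    by (simp only: Diff_iff mem_reflect_iff[OF that sub(1)] mem_reflect_iff[OF that sub(2)])
  have "reflect n I - reflect n I' = {u. u < n \<and> n - 1 - u \<in> I - I'}"
    using below mem by blast
  also have "\<dots> = (\<lambda>s. n - 1 - s) ` (I - I')"
  proof (intro equalityI subsetI)
    fix u assume "u \<in> {u. u < n \<and> n - 1 - u \<in> I - I'}"
    then show "u \<in> (\<lambda>s. n - 1 - s) ` (I - I')"
      by (intro image_eqI[of _ _ "n - 1 - u"]) auto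
  next
    fix u assume "u \<in> (\<lambda>s. n - 1 - s) ` (I - I')"
    then obtain s where s: "s \<in> I - I'" "u = n - 1 - s" by blast
    have "s < n"
      using paired_basis_diff_below[OF assms s(1)] .
    with s show "u \<in> {u. u < n \<and> n - 1 - u \<in> I - I'}" by auto
  qed
  finally show ?thesis .
qed

lemma multiplicity_reflect:
  assumes "paired_basis n k I" and "paired_basis n k I'"
  shows "multiplicity (reflect n I) (reflect n I') = multiplicity I I'"
proof -
  have "inj_on (\<lambda>s. n - 1 - s) (I - I')"
  proof (rule inj_onI)
    fix s t assume "s \<in> I - I'" "t \<in> I - I'" "n - 1 - s = n - 1 - t"
    then show "s = t"
      using paired_basis_diff_below[OF assms, of s] paired_basis_diff_below[OF assms, of t] by simp
  qed
  then show ?thesis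
    unfolding multiplicity_def reflect_diff[OF assms] by (rule card_image)
qed

section \<open>Reflection of the optimum\<close>

text \<open>
  Below \<open>n\<close> the signs are inherited from \<open>w\<close>. Only the sign of the atom at \<open>n\<close> needs an argument:
  under the reflected weights the certificate of the reflected basis sees nothing but this atom,
  and its mean agrees with the one under \<open>Bin(n, 1 - p)\<close>, which charges \<open>n\<close>.
\<close>

lemma feasible_reflect_weights:
  assumes I: "paired_basis n k I" and "even k" and "k \<le> n" and p: "0 < p" "p < 1"
    and w: "feasible n k p w" and supp: "supp n w = I"
  shows "feasible n k (1 - p) (reflect_weights n p w)"
    and "supp n (reflect_weights n p w) = reflect n I"
proof -
  let ?v = "reflect_weights n p w"
  let ?b = "binomial_weight n (1 - p)"
  have "annihilates n k (reflect_weights n p (\<lambda>s. w s - binomial_weight n p s))"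
    using w \<open>k \<le> n\<close> by (intro annihilates_reflect_weights) (simp add: feasible_iff_annihilates)
  moreover have "reflect_weights n p (\<lambda>s. w s - binomial_weight n p s) = (\<lambda>u. ?v u - ?b u)"
    using p by (simp add: fun_eq_iff reflect_weights_diff reflect_weights_binomial)
  ultimately have ann: "annihilates n k (\<lambda>u. ?v u - ?b u)"
    by simp
  have nonneg: "?v u \<ge> 0" if "u < n" for u
    using that p w by (simp add: reflect_weights_below feasible_def)
  have pos_below: "?v u > 0 \<longleftrightarrow> u \<in> reflect n I" if u: "u < n" for u
  proof -
    have "?v u > 0 \<longleftrightarrow> w (n - 1 - u) > 0"
    proof -
      have "p / (1 - p) * (real (u + 1) / real (n - u)) > 0" using u p by simp
      then show ?thesis unfolding reflect_weights_below[OF u] by (metis zero_less_mult_pos mult_pos_pos)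
    qed
    also have "\<dots> \<longleftrightarrow> n - 1 - u \<in> I"
      using supp u by (auto simp: supp_def)
    finally show ?thesis
      using mem_reflect_iff[OF u paired_basis_subset[OF I]] by simp
  qed
  have pos_top: "?v n > 0"
  proof -
    obtain q :: "real poly" where q: "degree q \<le> k" "\<And>s. poly q (real s) \<ge> 0"
      "\<And>s. s < n \<Longrightarrow> poly q (real s) = 0 \<longleftrightarrow> s \<in> reflect n I" "poly q (real n) > 0"
      using paired_basis_certificate[OF paired_basis_reflect[OF I] \<open>even k\<close>] by metis
    have split: "(\<Sum>s=0..n. u s * poly q (real s)) = u n * poly q (real n) + (\<Sum>s<n. u s * poly q (real s))"
      for u :: "nat \<Rightarrow> real"
      by (simp add: atLeast0AtMost lessThan_Suc_atMost[symmetric])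
    have "?v u * poly q (real u) = 0" if "u < n" for u
      using pos_below[OF that] nonneg[OF that] q(3)[OF that] by fastforce
    then have "?v n * poly q (real n) = (\<Sum>u=0..n. ?v u * poly q (real u))"
      unfolding split by (simp add: sum.neutral del: mult_eq_0_iff)
    also have "\<dots> = (\<Sum>u=0..n. ?b u * poly q (real u))"
      using ann q(1) by (simp add: annihilates_def left_diff_distrib sum_subtractf)
    also have "\<dots> \<ge> ?b n * poly q (real n)"
      unfolding split using p q(2) by (simp add: sum_nonneg binomial_weight_def)
    moreover have "?b n * poly q (real n) > 0"
      using p q(4) by (simp add: binomial_weight_def)
    ultimately have "?v n * poly q (real n) > 0" by linarith
    then show ?thesis using q(4) by (simp add: zero_less_mult_iff)
  qed
  have "?v u \<ge> 0" if "u \<le> n" for u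
    using that nonneg pos_top by (cases "u = n") auto
  then show "feasible n k (1 - p) ?v"
    using ann \<open>k \<le> n\<close> by (simp add: feasible_iff_annihilates reflect_weights_above)
  have "u \<in> supp n ?v \<longleftrightarrow> u \<in> reflect n I" for u
    using pos_below[of u] pos_top paired_basis_subset[OF paired_basis_reflect[OF I]]
    by (cases u n rule: linorder_cases) (auto simp: supp_def reflect_def)
  then show "supp n ?v = reflect n I" by blast
qed

lemma unique_optimal_support_reflect:
  assumes I: "paired_basis n k I" and "even k" and "k \<le> n" and "0 < p" "p < 1"
    and "unique_optimal_support n k p I"
  shows "unique_optimal_support n k (1 - p) (reflect n I)"
proof -
  obtain w where w: "feasible n k p w" "supp n w = I"
    using assms(6) unfolding unique_optimal_support_def optimal_def by blast
  let ?v = "reflect_weights n p w"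
  note v = feasible_reflect_weights[OF assms(1-5) w]
  note opt = feasible_on_paired_basis_optimal
    [OF paired_basis_reflect[OF I] \<open>even k\<close> \<open>k \<le> n\<close> v(1) equalityD1[OF v(2)]]
  show ?thesis
    unfolding unique_optimal_support_def using opt v(2) by blast
qed

lemma transition_reflect:
  assumes "even k" and "k \<le> n" and tr: "transition n k d I\<^sub>m I\<^sub>p"
  shows "transition n k (1 - d) (reflect n I\<^sub>p) (reflect n I\<^sub>m)"
proof -
  from tr have d: "0 < d" "d < 1" and Im: "paired_basis n k I\<^sub>m" and Ip: "paired_basis n k I\<^sub>p"
    and "I\<^sub>m \<noteq> I\<^sub>p"
    by (auto simp: transition_def)
  from tr obtain \<epsilon> where eps: "\<epsilon> > 0" "{d - \<epsilon><..<d + \<epsilon>} \<subseteq> {0<..<1}"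
    and left: "\<And>p. p \<in> {d - \<epsilon><..<d} \<Longrightarrow> unique_optimal_support n k p I\<^sub>m"
    and right: "\<And>p. p \<in> {d<..<d + \<epsilon>} \<Longrightarrow> unique_optimal_support n k p I\<^sub>p"
    unfolding transition_def by blast
  have inside: "0 < p \<and> p < 1" if "p \<in> {d - \<epsilon><..<d + \<epsilon>}" for p
    using eps(2) that by auto
  have "{(1 - d) - \<epsilon><..<(1 - d) + \<epsilon>} \<subseteq> {0<..<1}"
  proof
    fix p assume "p \<in> {(1 - d) - \<epsilon><..<(1 - d) + \<epsilon>}"
    then show "p \<in> {0<..<1}" using inside[of "1 - p"] by auto
  qed
  moreover have "unique_optimal_support n k p (reflect n I\<^sub>p)" if "p \<in> {(1 - d) - \<epsilon><..<1 - d}" for p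
    using unique_optimal_support_reflect[OF Ip assms(1,2), of "1 - p"] inside[of "1 - p"]
      right[of "1 - p"] that eps(1) by simp
  moreover have "unique_optimal_support n k p (reflect n I\<^sub>m)" if "p \<in> {1 - d<..<(1 - d) + \<epsilon>}" for p
    using unique_optimal_support_reflect[OF Im assms(1,2), of "1 - p"] inside[of "1 - p"]
      left[of "1 - p"] that eps(1) by simp
  moreover have "reflect n I\<^sub>p \<noteq> reflect n I\<^sub>m"
    using reflect_diff[OF Ip Im] reflect_diff[OF Im Ip] \<open>I\<^sub>m \<noteq> I\<^sub>p\<close> by blast
  ultimately show ?thesis
    unfolding transition_def using d eps(1) paired_basis_reflect[OF Ip] paired_basis_reflect[OF Im] by auto
qed

theorem corollary3:
  fixes n k :: nat and d :: real
  assumes "even k" and "2 \<le> k" and "k \<le> n - 1"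
    and "0 < d" and "d < 1"
  shows "(\<forall>I\<^sub>m I\<^sub>p. transition n k d I\<^sub>m I\<^sub>p \<longrightarrow>
            transition n k (1 - d) (reflect n I\<^sub>p) (reflect n I\<^sub>m) \<and>
            multiplicity (reflect n I\<^sub>p) (reflect n I\<^sub>m) = multiplicity I\<^sub>m I\<^sub>p) \<and>
         (exceptional n k d \<longrightarrow> exceptional n k (1 - d))"
proof -
  have "k \<le> n"
    using assms by auto
  have *: "transition n k (1 - d) (reflect n I\<^sub>p) (reflect n I\<^sub>m) \<and>
      multiplicity (reflect n I\<^sub>p) (reflect n I\<^sub>m) = multiplicity I\<^sub>m I\<^sub>p"
    if tr: "transition n k d I\<^sub>m I\<^sub>p" for I\<^sub>m I\<^sub>p
  proof -
    have bases: "paired_basis n k I\<^sub>m" "paired_basis n k I\<^sub>p"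
      using tr by (auto simp: transition_def)
    show ?thesis
      using transition_reflect[OF \<open>even k\<close> \<open>k \<le> n\<close> tr]
        multiplicity_reflect[OF bases(2,1)] multiplicity_commute[OF bases \<open>even k\<close>] by simp
  qed
  then show ?thesis
    unfolding exceptional_def by metis
qed

end
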